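(* Let $(X,d)$ be a nonempty complete metric space, let $T:X\to X$ be logically contractive with constant $\lambda\in(0,1)$ and event sequence $n_1<n_2<n_3<\cdots$, and let $z$ be the (unique) fixed point of $T$. If there is a real number $M$ such that $n_{k+1}-n_k\le M$ for all $k\ge 1$, then for every $x\in X$ and every integer $n\ge n_1$, $$d(T^n x,z)\;\le\;\lambda^{\,1+\left\lfloor \frac{n-n_1}{M}\right\rfloor}\,d(x,z).$$
   Context: For a self-map $T$ of a metric space $(X,d)$ and a positive integer $n$, $T^n$ denotes the $n$-fold composition (so $T^1=T$). For a self-map $S$ of $X$, $\mathrm{Lip}(S):=\sup_{x\ne y}\frac{d(Sx,Sy)}{d(x,y)}$ (equal to $0$ if $X$ has a single point). $T$ is nonexpansive if $\mathrm{Lip}(T)\le 1$. $\lfloor t\rfloor$ is the greatest integer $\le t$. Definition: $T:X\to X$ is logically contractive (with constant $\lambda$ and event sequence $(n_k)$) if $T$ is nonexpansive and there exist a constant $\lambda\in(0,1)$ and a strictly increasing sequence of positive integers $n_1<n_2<n_3<\cdots$ such that $\mathrm{Lip}(T^{n_k})\le\lambda^k$ for all $k\ge 1$. A logically contractive self-map of a nonempty complete metric space has a unique fixed point. *)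

theory Defs
  imports "HOL-Analysis.Analysis"
begin

(* X is the carrier of a metric space and d its metric, as in the locale Metric_space.
   The values are extended nonnegative reals, so that non-Lipschitz maps are covered;
   the supremum of the empty set is then 0, which is the convention for one-point spaces. *)
definition Lip :: "'a set \<Rightarrow> ('a \<Rightarrow> 'a \<Rightarrow> real) \<Rightarrow> ('a \<Rightarrow> 'a) \<Rightarrow> ennreal" where
  "Lip X d S = (SUP (x, y) \<in> {(x, y). x \<in> X \<and> y \<in> X \<and> x \<noteq> y}. ennreal (d (S x) (S y) / d x y))"

definition nonexpansive :: "'a set \<Rightarrow> ('a \<Rightarrow> 'a \<Rightarrow> real) \<Rightarrow> ('a \<Rightarrow> 'a) \<Rightarrow> bool" where
  "nonexpansive X d T \<longleftrightarrow> Lip X d T \<le> 1"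

(* The event sequence is indexed from 1; the value N 0 is irrelevant. *)
definition logically_contractive ::
  "'a set \<Rightarrow> ('a \<Rightarrow> 'a \<Rightarrow> real) \<Rightarrow> ('a \<Rightarrow> 'a) \<Rightarrow> real \<Rightarrow> (nat \<Rightarrow> nat) \<Rightarrow> bool" where
  "logically_contractive X d T lam N \<longleftrightarrow>
     nonexpansive X d T \<and> 0 < lam \<and> lam < 1 \<and>
     strict_mono_on {1..} N \<and> (\<forall>k\<ge>1. 0 < N k) \<and>
     (\<forall>k\<ge>1. Lip X d (T ^^ N k) \<le> ennreal (lam ^ k))"

end

theory Submission
  imports Defs
begin

text \<open>Let \<open>k \<ge> 1\<close> with \<open>N k \<le> n\<close>. The first \<open>N k\<close> iterations shrink the distance to the fixed point
  by the factor \<open>lam ^ k\<close>, and the remaining \<open>n - N k\<close> do not increase it, because \<open>T\<close> is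
  nonexpansive and fixes \<open>z\<close> (\<open>event_dist_fixpoint_le\<close>). It remains to count the events up to
  time \<open>n\<close>: gaps of at most \<open>M\<close> give \<open>N (1 + j) \<le> N 1 + j * M\<close>
  (\<open>bounded_gaps_imp_linear_growth\<close>), so \<open>k = 1 + \<lfloor>(n - N 1) / M\<rfloor>\<close> is an admissible choice.\<close>

text \<open>The supremum \<open>Lip\<close> ranges over distinct points only; on the diagonal the bound holds
  because both distances vanish, which needs \<open>S\<close> to map into the carrier.\<close>

lemma dist_le_of_Lip_le:
  assumes "Metric_space X d" "S \<in> X \<rightarrow> X" "Lip X d S \<le> ennreal c" "0 \<le> c" "x \<in> X" "y \<in> X"
  shows "d (S x) (S y) \<le> c * d x y"
proof (cases "x = y")
  case True
  then show ?thesis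
    using assms Metric_space.mdist_zero[of X d] by (auto simp: Pi_iff)
next
  case False
  then have "0 < d x y"
    using assms by (simp add: Metric_space.mdist_pos_eq)
  have "ennreal (d (S x) (S y) / d x y) \<le> Lip X d S"
    unfolding Lip_def using assms False by (intro SUP_upper2[of "(x, y)"]) auto
  with assms have "d (S x) (S y) / d x y \<le> c"
    by (metis ennreal_le_iff order_trans)
  with \<open>0 < d x y\<close> show ?thesis
    by (simp add: divide_le_eq)
qed

lemma funpow_in_carrier: "T \<in> X \<rightarrow> X \<Longrightarrow> (T ^^ n) \<in> X \<rightarrow> X"
  by (induction n) auto

lemma dist_fixpoint_antimono:
  assumes "Metric_space X d" "T \<in> X \<rightarrow> X" "nonexpansive X d T"
    and "x \<in> X" "z \<in> X" "T z = z" "m \<le> n"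
  shows "d ((T ^^ n) x) z \<le> d ((T ^^ m) x) z"
  using \<open>m \<le> n\<close>
proof (induction n rule: dec_induct)
  case (step n)
  have "(T ^^ n) x \<in> X"
    using funpow_in_carrier[OF assms(2)] assms(4) by blast
  then have "d (T ((T ^^ n) x)) (T z) \<le> 1 * d ((T ^^ n) x) z"
    using assms by (intro dist_le_of_Lip_le[of X]) (auto simp: nonexpansive_def)
  with step.IH \<open>T z = z\<close> show ?case
    by simp
qed simp

lemma event_dist_fixpoint_le:
  assumes "Metric_space X d" "T \<in> X \<rightarrow> X" "logically_contractive X d T lam N"
    and "x \<in> X" "z \<in> X" "T z = z" "1 \<le> k" "N k \<le> n"
  shows "d ((T ^^ n) x) z \<le> lam ^ k * d x z"
proof -
  have "(T ^^ i) z = z" for i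
    using \<open>T z = z\<close> by (induction i) auto
  moreover have "d ((T ^^ N k) x) ((T ^^ N k) z) \<le> lam ^ k * d x z"
    using assms
    by (intro dist_le_of_Lip_le[of X] funpow_in_carrier) (auto simp: logically_contractive_def)
  moreover have "d ((T ^^ n) x) z \<le> d ((T ^^ N k) x) z"
    using assms by (intro dist_fixpoint_antimono[of X]) (auto simp: logically_contractive_def)
  ultimately show ?thesis
    by simp
qed

lemma bounded_gaps_imp_linear_growth:
  fixes N :: "nat \<Rightarrow> nat" and M :: real
  assumes "\<And>k. k \<ge> 1 \<Longrightarrow> real (N (k + 1)) - real (N k) \<le> M"
  shows "real (N (1 + j)) \<le> real (N 1) + real j * M"
proof (induction j)
  case (Suc j)
  with assms[of "1 + j"] show ?case
    by (simp add: algebra_simps)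
qed simp

theorem corollary2p4:
  fixes X :: "'a set" and d :: "'a \<Rightarrow> 'a \<Rightarrow> real" and T :: "'a \<Rightarrow> 'a"
    and lam M :: real and N :: "nat \<Rightarrow> nat" and z :: 'a
  assumes "Metric_space X d"
    and "X \<noteq> {}"
    and "Metric_space.mcomplete X d"
    and "T \<in> X \<rightarrow> X"
    and "logically_contractive X d T lam N"
    and "z \<in> X" and "T z = z"
    and "\<And>k. k \<ge> 1 \<Longrightarrow> real (N (k + 1)) - real (N k) \<le> M"
  shows "\<forall>x\<in>X. \<forall>n\<ge>N 1.
    d ((T ^^ n) x) z \<le> lam powi (1 + \<lfloor>(real n - real (N 1)) / M\<rfloor>) * d x z"
proof (intro ballI allI impI)
  fix x n assume "x \<in> X" and n: "N 1 \<le> n"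
  \<comment> \<open>As the first gap is positive, so is \<open>M\<close>; hence the floor is nonnegative and indexes an event.\<close>
  have "N 1 < N 2"
    using assms(5) by (auto simp: logically_contractive_def strict_mono_on_def)
  with assms(8)[of 1] have M: "0 < M"
    by (simp add: numeral_2_eq_2)
  define j where "j = nat \<lfloor>(real n - real (N 1)) / M\<rfloor>"
  have j: "int j = \<lfloor>(real n - real (N 1)) / M\<rfloor>"
    using M n by (simp add: j_def)
  then have "real j \<le> (real n - real (N 1)) / M"
    by (metis of_int_floor_le of_int_of_nat_eq)
  then have "real j * M \<le> real n - real (N 1)"
    using M by (simp add: pos_le_divide_eq)
  moreover have "real (N (1 + j)) \<le> real (N 1) + real j * M"
    using assms(8) by (rule bounded_gaps_imp_linear_growth)
  ultimately have "N (1 + j) \<le> n"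
    by linarith
  then have "d ((T ^^ n) x) z \<le> lam ^ (1 + j) * d x z"
    using assms \<open>x \<in> X\<close> by (intro event_dist_fixpoint_le[of X]) auto
  also have "lam ^ (1 + j) = lam powi (1 + \<lfloor>(real n - real (N 1)) / M\<rfloor>)"
    unfolding j[symmetric] by (metis of_nat_1 of_nat_add power_int_of_nat)
  finally show "d ((T ^^ n) x) z \<le> lam powi (1 + \<lfloor>(real n - real (N 1)) / M\<rfloor>) * d x z" .
qed

end
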